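(* If $H$ is a graph in which every edge lies in a triangle and $t\geq e(H)$ is an integer, then \[\operatorname{sat}_t(n,\mathfrak{R}(H))\geq \left(\frac{1}{4t}+o(1)\right)n\log n \quad (n\to\infty).\]
   Context: A $t$-edge-coloured graph is a graph $G$ with a function $c:E(G)\to\{1,\dots,t\}$ (not necessarily proper). A copy of $H$ is rainbow if all its edges receive distinct colours; $\mathfrak{R}(H)$ denotes the family of rainbow copies of $H$. A $t$-edge-coloured graph is $\mathfrak{R}(H)$-saturated if it contains no rainbow copy of $H$ but adding any non-edge in any colour from $\{1,\dots,t\}$ creates a rainbow copy of $H$. $\operatorname{sat}_t(n,\mathfrak{R}(H))$ is the minimum number of edges of such a graph on $n$ vertices. $e(H)$ is the number of edges of $H$. Logarithms are base 2. *)

theory Defs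
  imports Complex_Main "HOL-Library.FuncSet" "HOL-Library.Ramsey"
    "HOL-Library.Extended_Real" "HOL-Library.Landau_Symbols"
begin

type_synonym 'a ugraph = "'a set \<times> 'a set set"

abbreviation verts :: "'a ugraph \<Rightarrow> 'a set" where
  "verts G \<equiv> fst G"

abbreviation edges :: "'a ugraph \<Rightarrow> 'a set set" where
  "edges G \<equiv> snd G"

definition simple_graph :: "'a ugraph \<Rightarrow> bool" where
  "simple_graph G \<longleftrightarrow> finite (verts G) \<and> edges G \<subseteq> nsets (verts G) 2"

definition subgraph :: "'a ugraph \<Rightarrow> 'a ugraph \<Rightarrow> bool" where
  "subgraph F G \<longleftrightarrow> simple_graph F \<and> verts F \<subseteq> verts G \<and> edges F \<subseteq> edges G"

definition graph_isomorphic :: "'a ugraph \<Rightarrow> 'b ugraph \<Rightarrow> bool" where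
  "graph_isomorphic G H \<longleftrightarrow>
     (\<exists>\<phi>. bij_betw \<phi> (verts G) (verts H) \<and> edges H = (\<lambda>e. \<phi> ` e) ` edges G)"

definition every_edge_in_triangle :: "'a ugraph \<Rightarrow> bool" where
  "every_edge_in_triangle H \<longleftrightarrow>
     (\<forall>e\<in>edges H. \<exists>x y z. distinct [x, y, z] \<and> e = {x, y} \<and>
        {x, z} \<in> edges H \<and> {y, z} \<in> edges H)"

text \<open>A colouring is a total function on sets of vertices; only its values on edges matter.\<close>

definition edge_coloured_graph :: "nat \<Rightarrow> 'a ugraph \<Rightarrow> ('a set \<Rightarrow> nat) \<Rightarrow> bool" where
  "edge_coloured_graph t G c \<longleftrightarrow> simple_graph G \<and> c \<in> edges G \<rightarrow> {1..t}"

definition rainbow_copies :: "'b ugraph \<Rightarrow> ('a ugraph \<times> ('a set \<Rightarrow> nat)) set" where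
  "rainbow_copies H = {(F, c). simple_graph F \<and> graph_isomorphic F H \<and> inj_on c (edges F)}"

text \<open>Subgraphs need not be induced.\<close>

definition contains_rainbow_copy :: "'b ugraph \<Rightarrow> 'a ugraph \<Rightarrow> ('a set \<Rightarrow> nat) \<Rightarrow> bool" where
  "contains_rainbow_copy H G c \<longleftrightarrow> (\<exists>F. subgraph F G \<and> (F, c) \<in> rainbow_copies H)"

definition rainbow_saturated ::
    "nat \<Rightarrow> 'b ugraph \<Rightarrow> 'a ugraph \<Rightarrow> ('a set \<Rightarrow> nat) \<Rightarrow> bool" where
  "rainbow_saturated t H G c \<longleftrightarrow>
     edge_coloured_graph t G c \<and>
     \<not> contains_rainbow_copy H G c \<and>
     (\<forall>e \<in> nsets (verts G) 2 - edges G. \<forall>i \<in> {1..t}.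
        contains_rainbow_copy H (verts G, insert e (edges G)) (c(e := i)))"

text \<open>
  The minimum is taken in \<^typ>\<open>enat\<close>, so that it is \<open>\<infinity>\<close> when there is no saturated graph.
  For \<open>t \<ge> e(H)\<close> this only happens when \<open>H\<close> has no edges. Up to isomorphism, every finite
  graph has its vertices in \<^typ>\<open>nat\<close>.
\<close>

definition rainbow_sat :: "nat \<Rightarrow> nat \<Rightarrow> 'b ugraph \<Rightarrow> enat" where
  "rainbow_sat t n H =
     Inf {enat (card (edges G)) | (G :: nat ugraph) c.
            card (verts G) = n \<and> rainbow_saturated t H G c}"

end

theory Submission imports Defs "HOL-Real_Asymp.Real_Asymp" begin

text \<open>
  Adding a non-edge \<open>uv\<close> creates a rainbow triangle through it, so any two non-adjacent vertices
  have a common neighbour to which they are joined in different colours. Let \<open>A\<close> and \<open>B\<close> be the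
  sets of vertices of degree at most, respectively more than, \<open>log n\<close>. If \<open>A\<close> contains less than
  half of the vertices, then the degree sum suffices. Otherwise we follow Hansel's argument for
  covering complete graphs by bipartite graphs: pick a colour \<open>f w\<close> for every \<open>w \<in> B\<close> uniformly at
  random and keep those \<open>u \<in> A\<close> whose edges to \<open>B\<close> all have the colour picked at their end in \<open>B\<close>.
  Two vertices that are kept are adjacent or have a common neighbour in \<open>A\<close>, so \<open>O(log\<^sup>2 n)\<close>
  vertices are kept. As \<open>u\<close> is kept with probability \<open>t\<^sup>-\<^sup>d\<close>, where \<open>d\<close> is its number of neighbours
  in \<open>B\<close>, convexity bounds the average of \<open>d\<close> from below by about \<open>log n / log t\<close>.
\<close>

section \<open>Neighbourhoods and edge counts\<close>

definition neighbours :: "'a ugraph \<Rightarrow> 'a \<Rightarrow> 'a set" where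
  "neighbours G v = {w. {v, w} \<in> edges G}"

lemma neighbours_subset:
  assumes "simple_graph G"
  shows "neighbours G v \<subseteq> verts G"
  using assms by (auto simp: neighbours_def simple_graph_def nsets_def)

lemma finite_neighbours:
  assumes "simple_graph G"
  shows "finite (neighbours G v)"
  using assms neighbours_subset[OF assms, of v] finite_subset
  unfolding simple_graph_def by blast

lemma finite_edges:
  assumes "simple_graph G"
  shows "finite (edges G)"
  using assms finite_imp_finite_nsets[of "verts G" 2] finite_subset
  unfolding simple_graph_def by blast

lemma edge_card:
  assumes "simple_graph G" "e \<in> edges G"
  shows "card e = 2"
  using assms by (auto simp: simple_graph_def nsets_def)

lemma card_neighbours:
  assumes "simple_graph G"
  shows "card (neighbours G v) = card {e \<in> edges G. v \<in> e}"
proof (rule bij_betw_same_card[of "\<lambda>w. {v, w}"])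
  have "e \<in> (\<lambda>w. {v, w}) ` neighbours G v" if e: "e \<in> edges G" "v \<in> e" for e
  proof -
    from edge_card[OF assms e(1)] obtain x y where "e = {x, y}"
      by (auto simp: card_2_iff)
    with e show ?thesis
      by (auto simp: neighbours_def insert_commute)
  qed
  then show "bij_betw (\<lambda>w. {v, w}) (neighbours G v) {e \<in> edges G. v \<in> e}"
    by (auto simp: bij_betw_def inj_on_def neighbours_def doubleton_eq_iff)
qed

lemma degree_sum:
  assumes "simple_graph G"
  shows "(\<Sum>v\<in>verts G. card (neighbours G v)) = 2 * card (edges G)"
proof -
  have fin: "finite (verts G)" "finite (edges G)"
    using assms finite_edges[OF assms] by (auto simp: simple_graph_def)
  have "card {v \<in> verts G. v \<in> e} = 2" if "e \<in> edges G" for e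
  proof -
    have "{v \<in> verts G. v \<in> e} = e"
      using that assms by (auto simp: simple_graph_def nsets_def)
    with edge_card[OF assms that] show ?thesis by simp
  qed
  with sum_multicount[OF fin, of "\<lambda>v e. v \<in> e" 2] show ?thesis
    by (simp add: card_neighbours[OF assms])
qed

text \<open>Since \<open>A\<close> and \<open>B\<close> are disjoint, an edge determines which of
  its ends lies in \<open>A\<close>, so no edge is counted twice. This turns a bound on the average
  number of \<open>B\<close>-neighbours into a bound on edges.\<close>

lemma sum_card_neighbours_Int_le:
  assumes "simple_graph G" "finite A" "A \<inter> B = {}"
  shows "(\<Sum>u\<in>A. card (neighbours G u \<inter> B)) \<le> card (edges G)"
proof -
  have "(\<Sum>u\<in>A. card (neighbours G u \<inter> B)) = card (SIGMA u:A. neighbours G u \<inter> B)"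
    using assms finite_neighbours[OF assms(1)] by simp
  also have "\<dots> \<le> card (edges G)"
  proof (rule card_inj_on_le[of "\<lambda>(u, w). {u, w}"])
    show "inj_on (\<lambda>(u, w). {u, w}) (SIGMA u:A. neighbours G u \<inter> B)"
      using assms(3) by (auto simp: inj_on_def doubleton_eq_iff)
  qed (auto simp: neighbours_def finite_edges[OF assms(1)])
  finally show ?thesis .
qed

section \<open>Triangles in rainbow copies and common neighbours\<close>

lemma every_edge_in_triangleE:
  assumes "every_edge_in_triangle H" "e \<in> edges H"
  obtains x y z where "distinct [x, y, z]" "e = {x, y}" "{x, z} \<in> edges H" "{y, z} \<in> edges H"
  using bspec[OF assms(1)[unfolded every_edge_in_triangle_def] assms(2)]
  by (elim exE conjE) (rule that)

lemma every_edge_in_triangle_isomorphic: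
  assumes F: "simple_graph F" and iso: "graph_isomorphic F H" and H: "every_edge_in_triangle H"
  shows "every_edge_in_triangle F"
  unfolding every_edge_in_triangle_def
proof
  fix e assume e: "e \<in> edges F"
  obtain \<phi> where bij: "bij_betw \<phi> (verts F) (verts H)"
    and eH: "edges H = (\<lambda>e. \<phi> ` e) ` edges F"
    using iso by (auto simp: graph_isomorphic_def)
  have sub: "f \<subseteq> verts F" if "f \<in> edges F" for f
    using that F by (auto simp: simple_graph_def nsets_def)
  have inj: "inj_on \<phi> (verts F)"
    using bij by (simp add: bij_betw_def)
  \<comment> \<open>\<open>\<phi>\<close> is injective on vertices, hence on vertex sets, so edges
    of \<open>H\<close> pull back to edges of \<open>F\<close>.\<close>
  have edgeD: "{a, b} \<in> edges F" if "a \<in> verts F" "b \<in> verts F" "{\<phi> a, \<phi> b} \<in> edges H" for a b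
  proof -
    from that(3) obtain f where f: "f \<in> edges F" "\<phi> ` f = \<phi> ` {a, b}"
      using eH by auto
    with sub[OF f(1)] that(1,2) have "f = {a, b}"
      using inj_on_image_eq_iff[OF inj, of f "{a, b}"] by simp
    with f show ?thesis by simp
  qed
  have "\<phi> ` e \<in> edges H"
    using e eH by simp
  then obtain x y z where xyz: "distinct [x, y, z]" "\<phi> ` e = {x, y}" "{x, z} \<in> edges H" "{y, z} \<in> edges H"
    using every_edge_in_triangleE[OF H] by metis
  have "f \<subseteq> \<phi> ` verts F" if "f \<in> edges H" for f
    using that eH sub by (auto intro!: imageI)
  from this[OF xyz(3)] this[OF xyz(4)] have "x \<in> \<phi> ` verts F" "y \<in> \<phi> ` verts F" "z \<in> \<phi> ` verts F"
    by simp_all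
  then obtain a b w where ab: "a \<in> verts F" "b \<in> verts F" "w \<in> verts F"
    and \<phi>: "\<phi> a = x" "\<phi> b = y" "\<phi> w = z"
    by (elim imageE) simp
  have "\<phi> ` e = \<phi> ` {a, b}"
    using xyz(2) \<phi> by simp
  then have "e = {a, b}"
    using inj_on_image_eq_iff[OF inj, of e "{a, b}"] sub[OF e] ab by simp
  moreover have "distinct [a, b, w]"
    using xyz(1) \<phi> by auto
  moreover have "{a, w} \<in> edges F" "{b, w} \<in> edges F"
    using edgeD ab \<phi> xyz by auto
  ultimately show "\<exists>x y z. distinct [x, y, z] \<and> e = {x, y} \<and> {x, z} \<in> edges F \<and> {y, z} \<in> edges F"
    by blast
qed

text \<open>The rainbow copy created by adding \<open>{u, v}\<close> must use that edge. A triangle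
  of the copy through it has \<open>w\<close> as its third vertex, and its other two edges already
  lie in \<open>G\<close>.\<close>

lemma saturated_common_neighbour:
  assumes sat: "rainbow_saturated t H G c" and H: "every_edge_in_triangle H" and "t \<ge> 1"
    and uv: "u \<in> verts G" "v \<in> verts G" "u \<noteq> v" "{u, v} \<notin> edges G"
  obtains w where "{u, w} \<in> edges G" "{v, w} \<in> edges G" "c {u, w} \<noteq> c {v, w}"
proof -
  \<comment> \<open>Any single colour for the new edge suffices; 1 is available as
    \<open>t \<ge> 1\<close>.\<close>
  define c' where "c' = c({u, v} := 1)"
  have "{u, v} \<in> nsets (verts G) 2 - edges G"
    using uv by (auto simp: nsets_def)
  then have "contains_rainbow_copy H (verts G, insert {u, v} (edges G)) c'"
    using sat \<open>t \<ge> 1\<close> unfolding rainbow_saturated_def c'_def by simp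
  then obtain F where F: "subgraph F (verts G, insert {u, v} (edges G))" "simple_graph F"
    "graph_isomorphic F H" "inj_on c' (edges F)"
    by (auto simp: contains_rainbow_copy_def rainbow_copies_def)
  have "{u, v} \<in> edges F"
  proof (rule ccontr)
    assume nin: "{u, v} \<notin> edges F"
    then have "inj_on c (edges F)"
      using F(4) unfolding c'_def inj_on_def by (metis fun_upd_other)
    moreover have "subgraph F G"
      using F(1) nin by (auto simp: subgraph_def)
    ultimately have "contains_rainbow_copy H G c"
      using F(2,3) unfolding contains_rainbow_copy_def rainbow_copies_def by blast
    with sat show False by (simp add: rainbow_saturated_def)
  qed
  then obtain x y w where xyw: "distinct [x, y, w]" "{u, v} = {x, y}" "{x, w} \<in> edges F" "{y, w} \<in> edges F"
    using every_edge_in_triangleE[OF every_edge_in_triangle_isomorphic[OF F(2,3) H]] by metis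
  have uw: "{u, w} \<in> edges F" "{v, w} \<in> edges F" "w \<noteq> u" "w \<noteq> v"
    using xyw by (auto simp: doubleton_eq_iff)
  then have ne: "{u, w} \<noteq> {u, v}" "{v, w} \<noteq> {u, v}" "{u, w} \<noteq> {v, w}"
    using uv(3) by (auto simp: doubleton_eq_iff)
  have "{u, w} \<in> edges G" "{v, w} \<in> edges G"
    using uw ne F(1) by (auto simp: subgraph_def)
  moreover have "c' {u, w} \<noteq> c' {v, w}"
    using F(4) uw ne unfolding inj_on_def by blast
  then have "c {u, w} \<noteq> c {v, w}"
    using ne by (simp add: c'_def)
  ultimately show ?thesis by (rule that)
qed

section \<open>Convexity and Hansel's counting\<close>

lemma ln_bound_of_sum_inverse_powers:
  fixes d :: "'a \<Rightarrow> nat" and K s :: real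
  assumes "finite A" "K > 0" "s > 0" and sum: "(\<Sum>u\<in>A. 1 / s ^ d u) \<le> K"
  shows "real (card A) * ln (real (card A) / K) \<le> real (\<Sum>u\<in>A. d u) * ln s"
proof (cases "A = {}")
  case False
  \<comment> \<open>The tangent bound \<open>ln x \<le> x - 1\<close> is applied at
    \<open>x = q / s ^ d u\<close>. With this \<open>q\<close> the right-hand sides add up to at
    most \<open>q * K - card A = 0\<close>.\<close>
  define q where "q = real (card A) / K"
  have q: "q > 0"
    using False assms by (simp add: q_def card_gt_0_iff)
  have "ln q - real (d u) * ln s \<le> q * (1 / s ^ d u) - 1" for u
  proof -
    have "ln (q / s ^ d u) = ln q - real (d u) * ln s"
      using q assms(3) by (simp add: ln_div ln_realpow)
    moreover have "ln (q / s ^ d u) \<le> q / s ^ d u - 1"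
      using q assms(3) by (intro ln_le_minus_one) simp
    ultimately show ?thesis by simp
  qed
  then have "(\<Sum>u\<in>A. ln q - real (d u) * ln s) \<le> (\<Sum>u\<in>A. q * (1 / s ^ d u) - 1)"
    by (intro sum_mono)
  also have "\<dots> = q * (\<Sum>u\<in>A. 1 / s ^ d u) - real (card A)"
    by (simp only: sum_subtractf sum_distrib_left) simp
  also have "\<dots> \<le> q * K - real (card A)"
    using mult_left_mono[OF sum, of q] q by simp
  also have "\<dots> = 0"
    using assms(2) by (simp add: q_def)
  finally show ?thesis
    by (simp add: sum_subtractf sum_distrib_right q_def)
qed simp

text \<open>The expected number of kept vertices is at most \<open>K\<close>, as every outcome keeps
  at most \<open>K\<close>. In counting form: double count the pairs of a vertex \<open>u\<close>
  and a choice \<open>f\<close> that keeps it.\<close>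

lemma Hansel_count:
  fixes c :: "'a set \<Rightarrow> nat"
  assumes "finite A" "finite B" "t \<ge> 1"
    and col: "\<And>u w. u \<in> A \<Longrightarrow> w \<in> neighbours G u \<inter> B \<Longrightarrow> c {u, w} \<in> {1..t}"
    and small: "\<And>f. real (card {u \<in> A. \<forall>w \<in> neighbours G u \<inter> B. c {u, w} = f w}) \<le> K"
  shows "(\<Sum>u\<in>A. 1 / real t ^ card (neighbours G u \<inter> B)) \<le> K"
proof -
  define \<Omega> where "\<Omega> = B \<rightarrow>\<^sub>E {1..t}"
  define kept where "kept u f \<longleftrightarrow> (\<forall>w \<in> neighbours G u \<inter> B. c {u, w} = f w)" for u and f :: "'a \<Rightarrow> nat"
  have fin: "finite \<Omega>" and card\<Omega>: "card \<Omega> = t ^ card B"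
    using assms(2) by (auto simp: \<Omega>_def card_PiE finite_PiE)
  have count: "real (card {f \<in> \<Omega>. kept u f}) = real t ^ card B * (1 / real t ^ card (neighbours G u \<inter> B))"
    if u: "u \<in> A" for u
  proof -
    let ?N = "neighbours G u"
    \<comment> \<open>The choice is forced at neighbours of \<open>u\<close> and free elsewhere in
      \<open>B\<close>; by \<open>col\<close> the forced values are legal choices.\<close>
    have "{f \<in> \<Omega>. kept u f} = PiE B (\<lambda>w. if w \<in> ?N then {c {u, w}} else {1..t})"
      using col[OF u] unfolding \<Omega>_def kept_def
      by (fastforce simp: PiE_iff split: if_splits)
    then have "card {f \<in> \<Omega>. kept u f} = (\<Prod>w\<in>B. if w \<in> ?N then 1 else t)"
      using assms(2) by (simp add: card_PiE if_distrib cong: if_cong)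
    also have "\<dots> = t ^ card (B - ?N)"
      using assms(2) by (simp add: prod.If_cases Diff_eq)
    finally have "card {f \<in> \<Omega>. kept u f} = t ^ card (B - ?N)" .
    moreover have "card B = card (B - ?N) + card (?N \<inter> B)"
      using assms(2) card_Diff_subset_Int[of B ?N] card_mono[of B "B \<inter> ?N"]
      by (simp add: Int_commute)
    ultimately show ?thesis
      using \<open>t \<ge> 1\<close> by (simp add: power_add)
  qed
  have "real t ^ card B * (\<Sum>u\<in>A. 1 / real t ^ card (neighbours G u \<inter> B))
      = (\<Sum>u\<in>A. real (card {f \<in> \<Omega>. kept u f}))"
    by (simp add: sum_distrib_left count)
  also have "\<dots> = (\<Sum>f\<in>\<Omega>. real (card {u \<in> A. kept u f}))"
    using sum_multicount_gen[OF assms(1) fin, of kept "\<lambda>f. card {u \<in> A. kept u f}"]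
    by (simp flip: of_nat_sum)
  also have "\<dots> \<le> (\<Sum>f\<in>\<Omega>. K)"
    using small by (intro sum_mono) (simp add: kept_def)
  also have "\<dots> = real t ^ card B * K"
    by (simp add: card\<Omega>)
  finally show ?thesis
    using \<open>t \<ge> 1\<close> by simp
qed

text \<open>Fix one kept vertex \<open>u\<close>. Any other kept vertex is adjacent to
  \<open>u\<close> or shares a neighbour with it inside \<open>A\<close>: at a common neighbour
  \<open>w\<close> outside \<open>A\<close> both edges would have colour \<open>f w\<close>.\<close>

lemma card_kept_le:
  fixes D :: real and f :: "'a \<Rightarrow> nat"
  assumes sat: "rainbow_saturated t H G c" and H: "every_edge_in_triangle H" and "t \<ge> 1" "D \<ge> 0"
    and A: "A \<subseteq> verts G" "\<And>u. u \<in> A \<Longrightarrow> real (card (neighbours G u)) \<le> D"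
  shows "real (card {u \<in> A. \<forall>w \<in> neighbours G u \<inter> (verts G - A). c {u, w} = f w}) \<le> 1 + D + D\<^sup>2"
    (is "real (card ?S) \<le> _")
proof (cases "?S = {}")
  case False
  then obtain u where u: "u \<in> ?S" by blast
  have G: "simple_graph G"
    using sat by (simp add: rainbow_saturated_def edge_coloured_graph_def)
  let ?N = "neighbours G"
  \<comment> \<open>Only neighbours in \<open>A\<close> are expanded, since the degree bound
    \<open>D\<close> is available only there.\<close>
  let ?T = "\<Union>w\<in>?N u \<inter> A. ?N w"
  have sub: "?S \<subseteq> {u} \<union> ?N u \<union> ?T"
  proof
    fix v assume v: "v \<in> ?S"
    show "v \<in> {u} \<union> ?N u \<union> ?T"
    proof (cases "u = v \<or> {u, v} \<in> edges G")
      case False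
      then obtain w where w: "{u, w} \<in> edges G" "{v, w} \<in> edges G" "c {u, w} \<noteq> c {v, w}"
        using saturated_common_neighbour[OF sat H \<open>t \<ge> 1\<close>, of u v] u v A(1) by blast
      then have "w \<in> ?N u" "w \<in> ?N v" "v \<in> ?N w"
        by (auto simp: neighbours_def insert_commute)
      moreover have "w \<in> A"
      proof (rule ccontr)
        assume "w \<notin> A"
        with calculation neighbours_subset[OF G, of u] have "w \<in> verts G - A"
          by blast
        with calculation u v have "c {u, w} = f w" "c {v, w} = f w"
          by blast+
        with w(3) show False by simp
      qed
      ultimately show ?thesis by blast
    qed (auto simp: neighbours_def)
  qed
  have T: "real (card ?T) \<le> D\<^sup>2"
  proof -
    have "real (card ?T) \<le> (\<Sum>w\<in>?N u \<inter> A. real (card (?N w)))"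
      using card_UN_le[of "?N u \<inter> A" ?N] finite_neighbours[OF G] by (simp flip: of_nat_sum)
    also have "\<dots> \<le> real (card (?N u \<inter> A)) * D"
      using A(2) by (intro sum_bounded_above) auto
    also have "\<dots> \<le> D * D"
    proof (rule mult_right_mono)
      have "card (?N u \<inter> A) \<le> card (?N u)"
        by (intro card_mono finite_neighbours G) auto
      with A(2)[of u] u show "real (card (?N u \<inter> A)) \<le> D" by simp
    qed fact
    finally show ?thesis by (simp add: power2_eq_square)
  qed
  have "card ?S \<le> card ({u} \<union> ?N u \<union> ?T)"
    using sub by (intro card_mono) (auto simp: finite_neighbours[OF G])
  also have "\<dots> \<le> card {u} + card (?N u) + card ?T"
    by (meson card_Un_le add_le_mono order_trans order_refl)
  finally have "real (card ?S) \<le> 1 + real (card (?N u)) + real (card ?T)"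
    by simp
  with T A(2)[of u] u show ?thesis by simp
next
  case True
  with \<open>D \<ge> 0\<close> show ?thesis by (simp only:) simp
qed

section \<open>The lower bound for a single saturated graph\<close>

lemma saturated_edges_lower_bound:
  assumes sat: "rainbow_saturated t H G c" and H: "every_edge_in_triangle H" and "t \<ge> 1"
    and n: "card (verts G) = n" "n \<ge> 1"
    and large: "1 + log 2 (1 + log 2 n + (log 2 n)\<^sup>2) \<le> log 2 n / 2"
  shows "real n * log 2 n \<le> 4 * real t * real (card (edges G))"
proof -
  define D where "D = log 2 (real n)"
  define K where "K = 1 + D + D\<^sup>2"
  define A where "A = {v \<in> verts G. real (card (neighbours G v)) \<le> D}"
  define B where "B = verts G - A"
  have "D \<ge> 0"
    using n by (simp add: D_def)
  then have "K > 0"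
    by (simp add: K_def add_pos_nonneg)
  have G: "simple_graph G" and cG: "c \<in> edges G \<rightarrow> {1..t}"
    using sat by (auto simp: rainbow_saturated_def edge_coloured_graph_def)
  have finV: "finite (verts G)"
    using G by (simp add: simple_graph_def)
  then have fin: "finite A" "finite B" and AB: "A \<inter> B = {}" "A \<subseteq> verts G"
    by (auto simp: A_def B_def)
  have card_n: "card A + card B = n"
    using finV AB(2) n(1) card_mono[OF finV AB(2)] fin(1)
    by (simp add: B_def card_Diff_subset)
  show ?thesis
  proof (cases "2 * card A < n")
    \<comment> \<open>More than half of the vertices have degree above \<open>D\<close>, so the
      degree sum alone gives the bound.\<close>
    case True
    then have "real n / 2 * D \<le> real (card B) * D"
      using card_n \<open>D \<ge> 0\<close> by (intro mult_right_mono) auto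
    also have "\<dots> \<le> (\<Sum>v\<in>B. real (card (neighbours G v)))"
      by (intro sum_bounded_below) (auto simp: A_def B_def)
    also have "\<dots> \<le> (\<Sum>v\<in>verts G. real (card (neighbours G v)))"
      using finV by (intro sum_mono2) (auto simp: B_def)
    also have "\<dots> = 2 * real (card (edges G))"
      using arg_cong[OF degree_sum[OF G], of real] by simp
    finally have "real n * D \<le> 4 * real (card (edges G))"
      by simp
    also have "\<dots> \<le> 4 * real t * real (card (edges G))"
      using \<open>t \<ge> 1\<close> by (simp add: mult_right_mono)
    finally show ?thesis by (simp add: D_def)
  next
    case False
    define d where "d u = card (neighbours G u \<inter> B)" for u
    have "(\<Sum>u\<in>A. 1 / real t ^ d u) \<le> K"
      unfolding d_def
    proof (rule Hansel_count[OF fin \<open>t \<ge> 1\<close>])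
      show "c {u, w} \<in> {1..t}" if "w \<in> neighbours G u \<inter> B" for u w
        using that cG by (auto simp: neighbours_def)
      show "real (card {u \<in> A. \<forall>w\<in>neighbours G u \<inter> B. c {u, w} = f w}) \<le> K" for f
        unfolding K_def B_def
        by (rule card_kept_le[OF sat H \<open>t \<ge> 1\<close> \<open>D \<ge> 0\<close> AB(2)]) (simp add: A_def)
    qed
    then have "real (card A) * ln (real (card A) / K) \<le> real (\<Sum>u\<in>A. d u) * ln (real t)"
      using ln_bound_of_sum_inverse_powers[OF fin(1) \<open>K > 0\<close>, of "real t" d] \<open>t \<ge> 1\<close> by simp
    \<comment> \<open>Dividing by \<open>ln 2\<close> changes to base 2.\<close>
    then have main: "real (card A) * log 2 (real (card A) / K) \<le> real (\<Sum>u\<in>A. d u) * log 2 (real t)"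
      by (simp add: log_def divide_right_mono)
    have A: "real n / 2 \<le> real (card A)" "card A > 0"
      using False n by auto
    have "log 2 (real n / 2 / K) = D - 1 - log 2 K"
      using n \<open>K > 0\<close> by (simp only: log_divide) (simp add: log_divide D_def)
    \<comment> \<open>This is what \<open>large\<close> is for. One factor 1/2 is lost here and
      another in \<open>card A \<ge> n / 2\<close>, which accounts for the constant 4.\<close>
    then have "D / 2 \<le> log 2 (real n / 2 / K)"
      using large by (simp add: K_def D_def)
    also have "\<dots> \<le> log 2 (real (card A) / K)"
      using A n \<open>K > 0\<close> by (intro log_mono) (simp_all add: field_simps)
    finally have "real n / 2 * (D / 2) \<le> real (card A) * log 2 (real (card A) / K)"
      using A \<open>D \<ge> 0\<close> by (intro mult_mono) auto
    also note main
    also have "real (\<Sum>u\<in>A. d u) * log 2 (real t) \<le> real (card (edges G)) * real t"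
    proof (rule mult_mono)
      show "real (\<Sum>u\<in>A. d u) \<le> real (card (edges G))"
        unfolding d_def using sum_card_neighbours_Int_le[OF G fin(1) AB(1)] by (simp only: of_nat_le_iff)
      \<comment> \<open>The factor \<open>log 2 t\<close> from the convexity bound is weakened to
        \<open>t\<close>.\<close>
      have "real t \<le> 2 powr real t"
        using of_nat_less_two_power[of t, where ?'a = real] by (simp add: powr_realpow)
      then show "log 2 (real t) \<le> real t"
        using \<open>t \<ge> 1\<close> by (simp add: log_le_iff)
    qed (use \<open>t \<ge> 1\<close> in auto)
    finally show ?thesis
      by (simp add: D_def mult.commute mult.left_commute)
  qed
qed

theorem theorem2p2:
  fixes H :: "'a ugraph" and t :: nat
  assumes "simple_graph H"
    and "every_edge_in_triangle H"
    and "t \<ge> card (edges H)"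
  shows "\<exists>\<epsilon> :: nat \<Rightarrow> real. \<epsilon> \<in> o(\<lambda>_. 1) \<and>
    (\<forall>\<^sub>F n in sequentially.
       ereal_of_enat (rainbow_sat t n H) \<ge>
         ereal ((1 / (4 * real t) + \<epsilon> n) * real n * log 2 (real n)))"
proof (intro exI conjI)
  \<comment> \<open>The bound holds exactly for all large \<open>n\<close>, so the error term can be
    zero.\<close>
  show "(\<lambda>_. 0 :: real) \<in> o(\<lambda>_::nat. 1 :: real)"
    by simp
  have "\<forall>\<^sub>F n :: nat in sequentially. 1 + log 2 (1 + log 2 n + (log 2 n)\<^sup>2) \<le> log 2 n / 2"
    by real_asymp
  with eventually_ge_at_top[of 1]
  show "\<forall>\<^sub>F n in sequentially. ereal ((1 / (4 * real t) + 0) * real n * log 2 (real n))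
      \<le> ereal_of_enat (rainbow_sat t n H)"
  proof eventually_elim
    case (elim n)
    define r where "r = (1 / (4 * real t) + 0) * real n * log 2 (real n)"
    have "r \<le> real (card (edges G))"
      if "card (verts G) = n" "rainbow_saturated t H G c" for G :: "nat ugraph" and c
    \<comment> \<open>For \<open>t = 0\<close> division by zero makes \<open>r = 0\<close>.\<close>
    proof (cases "t = 0")
      case False
      with saturated_edges_lower_bound[OF that(2) assms(2) _ that(1) elim]
      show ?thesis by (simp add: r_def field_simps)
    qed (simp add: r_def)
    \<comment> \<open>Edge counts are integers, so \<open>r\<close> may be rounded up to get a lower
      bound in \<open>enat\<close>; an empty infimum is infinite and causes no exception.\<close>
    then have "enat (nat \<lceil>r\<rceil>) \<le> rainbow_sat t n H"
      unfolding rainbow_sat_def by (intro Inf_greatest) (auto simp: ceiling_le_iff nat_le_iff)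
    then have "ereal_of_enat (enat (nat \<lceil>r\<rceil>)) \<le> ereal_of_enat (rainbow_sat t n H)"
      by (simp only: ereal_of_enat_le_iff)
    moreover have "ereal r \<le> ereal_of_enat (enat (nat \<lceil>r\<rceil>))"
      by (simp add: real_nat_ceiling_ge)
    ultimately show ?case
      unfolding r_def by (rule order_trans[rotated])
  qed
qed

end
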